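(* Every periodic orbit of the Kepler-Heisenberg system has zero energy: if $\gamma:\mathbb{R}\to T^*(\mathbb{R}^3\setminus\{0\})$ is a solution of Hamilton's equations for $H$ which is periodic with some period $T>0$, then $H(\gamma(t))=0$ for all $t$.
   Context: Use canonical coordinates $(x,y,z,p_x,p_y,p_z)$ on $T^*(\mathbb{R}^3\setminus\{0\})$, where $\mathbb{R}^3$ is the Heisenberg group with coordinates $x,y,z$. The Kepler-Heisenberg Hamiltonian is $H=K-U$, where $$K=\tfrac12(P_X^2+P_Y^2),\qquad P_X=p_x-\tfrac12 y p_z,\qquad P_Y=p_y+\tfrac12 x p_z,$$ $$U=\frac{\alpha}{\rho^2},\qquad \rho=\left((x^2+y^2)^2+\tfrac1{16}z^2\right)^{1/4},\qquad \alpha=\frac{2}{\pi}.$$ Hamilton's equations are $\dot q=\partial H/\partial p_q$, $\dot p_q=-\partial H/\partial q$ for $q\in\{x,y,z\}$. The energy of a solution is the (constant) value of $H$ along it. *)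

theory Defs
  imports "HOL-Analysis.Analysis"
begin

(* A point of T*(R^3) is a pair (q, p) with q = (x, y, z) and p = (p_x, p_y, p_z);
   the removal of the origin from the base is imposed in hamiltonian_solution. *)
type_synonym phase = "(real^3) \<times> (real^3)"

definition P_X :: "phase \<Rightarrow> real" where
  "P_X = (\<lambda>(q, p). p $ 1 - 1/2 * (q $ 2) * (p $ 3))"

definition P_Y :: "phase \<Rightarrow> real" where
  "P_Y = (\<lambda>(q, p). p $ 2 + 1/2 * (q $ 1) * (p $ 3))"

definition kinetic :: "phase \<Rightarrow> real" where
  "kinetic w = 1/2 * ((P_X w)\<^sup>2 + (P_Y w)\<^sup>2)"

definition rho :: "real^3 \<Rightarrow> real" where
  "rho q = (((q $ 1)\<^sup>2 + (q $ 2)\<^sup>2)\<^sup>2 + 1/16 * (q $ 3)\<^sup>2) powr (1/4)"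

definition alpha :: real where
  "alpha = 2 / pi"

definition potential :: "real^3 \<Rightarrow> real" where
  "potential q = alpha / (rho q)\<^sup>2"

(* The energy is H = K - U.  At q = 0 the value is the junk value K - 0, never used below. *)
definition kepler_heisenberg :: "phase \<Rightarrow> real" where
  "kepler_heisenberg w = kinetic w - potential (fst w)"

definition dH_dq :: "(phase \<Rightarrow> real) \<Rightarrow> 3 \<Rightarrow> phase \<Rightarrow> real" where
  "dH_dq H i = (\<lambda>(q, p). deriv (\<lambda>s. H (q + s *\<^sub>R axis i 1, p)) 0)"

definition dH_dp :: "(phase \<Rightarrow> real) \<Rightarrow> 3 \<Rightarrow> phase \<Rightarrow> real" where
  "dH_dp H i = (\<lambda>(q, p). deriv (\<lambda>s. H (q, p + s *\<^sub>R axis i 1)) 0)"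

definition hamiltonian_solution :: "(phase \<Rightarrow> real) \<Rightarrow> (real \<Rightarrow> phase) \<Rightarrow> bool" where
  "hamiltonian_solution H \<gamma> \<longleftrightarrow>
     (\<forall>t. fst (\<gamma> t) \<noteq> 0) \<and>
     (\<forall>t i. ((\<lambda>\<tau>. fst (\<gamma> \<tau>) $ i) has_real_derivative dH_dp H i (\<gamma> t)) (at t) \<and>
            ((\<lambda>\<tau>. snd (\<gamma> \<tau>) $ i) has_real_derivative - dH_dq H i (\<gamma> t)) (at t))"

end

theory Submission
  imports Defs
begin

text \<open>
  Under the Heisenberg dilations \<open>(x, y, z) \<mapsto> (\<lambda>x, \<lambda>y, \<lambda>\<^sup>2z)\<close>, lifted to the cotangent bundle,
  \<open>H\<close> is homogeneous of degree \<open>-2\<close>. Hence the generator \<open>J = x p\<^sub>x + y p\<^sub>y + 2 z p\<^sub>z\<close> satisfies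
  \<open>J' = 2 H\<close> along solutions. On a periodic orbit \<open>J\<close> is periodic, so \<open>J'\<close> vanishes somewhere
  by Rolle's theorem, and \<open>H\<close> is conserved.
\<close>

text \<open>The fourth power of \<open>rho\<close>: a polynomial, so only the square root in
  \<open>potential_eq\<close> remains to be differentiated.\<close>

definition rho4 :: "real^3 \<Rightarrow> real" where
  "rho4 q = ((q $ 1)\<^sup>2 + (q $ 2)\<^sup>2)\<^sup>2 + 1/16 * (q $ 3)\<^sup>2"

lemma rho4_nonneg: "rho4 q \<ge> 0"
  by (simp add: rho4_def)

lemma rho4_pos:
  assumes "q \<noteq> 0"
  shows "rho4 q > 0"
proof -
  have "rho4 q \<noteq> 0"
    using assms unfolding rho4_def
    by (auto simp: add_nonneg_eq_0_iff vec_eq_iff forall_3)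
  then show ?thesis
    using rho4_nonneg[of q] by linarith
qed

lemma potential_eq: "potential q = alpha / sqrt (rho4 q)"
proof -
  have "(rho q)\<^sup>2 = rho4 q powr (1/2)"
    unfolding rho_def rho4_def[symmetric] by (simp add: power2_eq_square powr_add[symmetric])
  then show ?thesis
    using rho4_nonneg[of q] by (simp add: potential_def powr_half_sqrt)
qed

lemma has_derivative_inverse_sqrt:
  assumes "(f has_real_derivative D) (at t)" and "f t > 0"
  shows "((\<lambda>t. c / sqrt (f t)) has_real_derivative - (c / (2 * f t * sqrt (f t))) * D) (at t)"
  using assms by (auto intro!: derivative_eq_intros simp: field_simps)

text \<open>The chain rule along an arbitrary curve. A single computation then serves both for the
  partial derivatives, using straight lines in one coordinate, and for conservation of energy, using
  the solution itself.\<close>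

lemma has_derivative_kepler_heisenberg:
  fixes q p :: "real \<Rightarrow> real^3"
  assumes q: "\<And>i. ((\<lambda>t. q t $ i) has_real_derivative q' $ i) (at t)"
    and p: "\<And>i. ((\<lambda>t. p t $ i) has_real_derivative p' $ i) (at t)"
    and "q t \<noteq> 0"
  defines "a \<equiv> P_X (q t, p t)" and "b \<equiv> P_Y (q t, p t)"
    and "c \<equiv> alpha / (2 * rho4 (q t) * sqrt (rho4 (q t)))"
    and "s \<equiv> (q t $ 1)\<^sup>2 + (q t $ 2)\<^sup>2"
  shows "((\<lambda>t. kepler_heisenberg (q t, p t)) has_real_derivative
      a * (p' $ 1 - 1/2 * (q' $ 2 * p t $ 3 + q t $ 2 * p' $ 3))
    + b * (p' $ 2 + 1/2 * (q' $ 1 * p t $ 3 + q t $ 1 * p' $ 3))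
    + c * (4 * s * (q t $ 1 * q' $ 1 + q t $ 2 * q' $ 2) + 1/8 * q t $ 3 * q' $ 3)) (at t)"
proof -
  have R: "((\<lambda>t. rho4 (q t)) has_real_derivative
      4 * s * (q t $ 1 * q' $ 1 + q t $ 2 * q' $ 2) + 1/8 * q t $ 3 * q' $ 3) (at t)"
    unfolding rho4_def s_def
    by (rule derivative_eq_intros q refl | simp add: algebra_simps)+
  note U = has_derivative_inverse_sqrt[OF R rho4_pos[OF \<open>q t \<noteq> 0\<close>], of alpha, folded c_def]
  have K: "((\<lambda>t. kinetic (q t, p t)) has_real_derivative
      a * (p' $ 1 - 1/2 * (q' $ 2 * p t $ 3 + q t $ 2 * p' $ 3))
    + b * (p' $ 2 + 1/2 * (q' $ 1 * p t $ 3 + q t $ 1 * p' $ 3))) (at t)"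
    unfolding kinetic_def P_X_def P_Y_def a_def b_def prod.case
    by (rule derivative_eq_intros q p refl | simp add: algebra_simps)+
  show ?thesis
    unfolding kepler_heisenberg_def potential_eq fst_conv
    by (rule DERIV_cong[OF DERIV_diff[OF K U]]) simp
qed

text \<open>The factors \<open>axis i 1 $ k\<close> are Kronecker deltas, so one formula covers all
  three coordinates.\<close>

lemma dH_dp_kepler_heisenberg:
  assumes "q \<noteq> 0"
  shows "dH_dp kepler_heisenberg i (q, p) =
    axis i 1 $ 1 * P_X (q, p) + axis i 1 $ 2 * P_Y (q, p)
    + axis i 1 $ 3 * (1/2 * q $ 1 * P_Y (q, p) - 1/2 * q $ 2 * P_X (q, p))"
proof -
  have "((\<lambda>s. (p + s *\<^sub>R axis i 1) $ j) has_real_derivative axis i 1 $ j) (at 0)" for j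
    by (auto intro!: derivative_eq_intros)
  from has_derivative_kepler_heisenberg[of "\<lambda>_. q" 0, OF _ this] assms
  show ?thesis
    unfolding dH_dp_def prod.case
    by (intro DERIV_imp_deriv) (simp add: algebra_simps)
qed

lemma dH_dq_kepler_heisenberg:
  assumes "q \<noteq> 0"
  defines "c \<equiv> alpha / (2 * rho4 q * sqrt (rho4 q))" and "s \<equiv> (q $ 1)\<^sup>2 + (q $ 2)\<^sup>2"
  shows "dH_dq kepler_heisenberg i (q, p) =
      axis i 1 $ 1 * (1/2 * p $ 3 * P_Y (q, p) + c * (4 * s * q $ 1))
    + axis i 1 $ 2 * (c * (4 * s * q $ 2) - 1/2 * p $ 3 * P_X (q, p))
    + axis i 1 $ 3 * (c * (1/8 * q $ 3))"
proof -
  have "((\<lambda>s. (q + s *\<^sub>R axis i 1) $ j) has_real_derivative axis i 1 $ j) (at 0)" for j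
    by (auto intro!: derivative_eq_intros)
  from has_derivative_kepler_heisenberg[of "\<lambda>s. q + s *\<^sub>R axis i 1" _ 0 "\<lambda>_. p" 0, OF this] assms(1)
  show ?thesis
    unfolding dH_dq_def prod.case c_def s_def
    by (intro DERIV_imp_deriv) (simp add: algebra_simps)
qed

definition dilation_momentum :: "phase \<Rightarrow> real" where
  "dilation_momentum = (\<lambda>(q, p). q $ 1 * p $ 1 + q $ 2 * p $ 2 + 2 * q $ 3 * p $ 3)"

context
  fixes \<gamma> :: "real \<Rightarrow> phase"
  assumes solution: "hamiltonian_solution kepler_heisenberg \<gamma>"
begin

lemma solution_nonzero: "fst (\<gamma> t) \<noteq> 0"
  using solution by (simp add: hamiltonian_solution_def)

text \<open>The velocity is packed into a vector and the point split into a pair to match the chain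
  rule and the formulas for the partial derivatives.\<close>

lemma solution_position:
  "((\<lambda>t. fst (\<gamma> t) $ i) has_real_derivative
    (\<chi> i. dH_dp kepler_heisenberg i (fst (\<gamma> t), snd (\<gamma> t))) $ i) (at t)"
  using solution by (simp add: hamiltonian_solution_def)

lemma solution_momentum:
  "((\<lambda>t. snd (\<gamma> t) $ i) has_real_derivative
    (\<chi> i. - dH_dq kepler_heisenberg i (fst (\<gamma> t), snd (\<gamma> t))) $ i) (at t)"
  using solution by (simp add: hamiltonian_solution_def)

lemmas hamilton_simps =
  dH_dp_kepler_heisenberg[OF solution_nonzero] dH_dq_kepler_heisenberg[OF solution_nonzero]

lemma energy_conserved: "kepler_heisenberg (\<gamma> t) = kepler_heisenberg (\<gamma> t')"
proof -
  have "((\<lambda>t. kepler_heisenberg (fst (\<gamma> t), snd (\<gamma> t))) has_real_derivative 0) (at t)" for t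
    \<comment> \<open>Inserting Hamilton's equations makes the terms cancel in pairs. Without
      \<open>prod.collapse\<close> the pairs stay split, so that \<open>hamilton_simps\<close> can
      rewrite.\<close>
    by (rule DERIV_cong[OF has_derivative_kepler_heisenberg[OF solution_position
            solution_momentum solution_nonzero]])
      (simp add: hamilton_simps axis_def algebra_simps del: prod.collapse)
  then show ?thesis
    using DERIV_isconst_all[of "\<lambda>t. kepler_heisenberg (\<gamma> t)"] by simp
qed

lemma dilation_momentum_derivative:
  "((\<lambda>t. dilation_momentum (\<gamma> t)) has_real_derivative 2 * kepler_heisenberg (\<gamma> t)) (at t)"
proof -
  obtain q p where qp: "\<gamma> t = (q, p)" by force
  define R where "R = rho4 q"
  define c where "c = alpha / (2 * R * sqrt R)"
  have "R > 0"
    using rho4_pos solution_nonzero[of t] by (simp add: R_def qp)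
  \<comment> \<open>With the root hidden in \<open>c\<close>, the final identity is polynomial.
    \<open>R\<close> has dilation weight 4, so by Euler's identity the potential contributes
    \<open>- 4 * c * R\<close>, which is minus twice \<open>potential q\<close>.\<close>
  then have U: "potential q = 2 * c * R"
    by (simp add: potential_eq c_def R_def[symmetric])
  note pos = solution_position[of _ t, unfolded qp fst_conv snd_conv]
  note mom = solution_momentum[of _ t, unfolded qp fst_conv snd_conv]
  note dp = dH_dp_kepler_heisenberg[OF solution_nonzero[of t, unfolded qp fst_conv]]
  note dq = dH_dq_kepler_heisenberg[OF solution_nonzero[of t, unfolded qp fst_conv],
      folded R_def, folded c_def]
  have J: "((\<lambda>t. dilation_momentum (\<gamma> t)) has_real_derivative
      dH_dp kepler_heisenberg 1 (q, p) * p $ 1 - q $ 1 * dH_dq kepler_heisenberg 1 (q, p)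
    + (dH_dp kepler_heisenberg 2 (q, p) * p $ 2 - q $ 2 * dH_dq kepler_heisenberg 2 (q, p))
    + 2 * (dH_dp kepler_heisenberg 3 (q, p) * p $ 3 - q $ 3 * dH_dq kepler_heisenberg 3 (q, p)))
    (at t)"
    unfolding dilation_momentum_def case_prod_beta
    by (rule derivative_eq_intros pos mom refl | simp add: qp algebra_simps)+
  show ?thesis
    by (rule DERIV_cong[OF J])
      (simp add: dp dq axis_def qp kepler_heisenberg_def kinetic_def U R_def rho4_def
        P_X_def P_Y_def algebra_simps power2_eq_square)
qed

end

theorem lemma1:
  fixes \<gamma> :: "real \<Rightarrow> phase" and T :: real
  assumes "hamiltonian_solution kepler_heisenberg \<gamma>"
    and "T > 0"
    and "\<forall>t. \<gamma> (t + T) = \<gamma> t"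
  shows "\<forall>t. kepler_heisenberg (\<gamma> t) = 0"
proof
  fix t
  let ?J = "\<lambda>t. dilation_momentum (\<gamma> t)"
  have "?J T = ?J 0"
    using assms(3)[rule_format, of 0] by simp
  moreover obtain s where "?J T - ?J 0 = (T - 0) * (2 * kepler_heisenberg (\<gamma> s))"
    \<comment> \<open>The left side is zero by periodicity and \<open>T\<close> is positive, so the
      energy vanishes at \<open>s\<close>.\<close>
    using MVT2[OF assms(2) dilation_momentum_derivative[OF assms(1)]] by blast
  ultimately have "kepler_heisenberg (\<gamma> s) = 0"
    using assms(2) by simp
  then show "kepler_heisenberg (\<gamma> t) = 0"
    using energy_conserved[OF assms(1)] by metis
qed

end
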